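(* Let $\mathcal{L}\subseteq\{+,-,0\}^E$ be the set of covectors of a loopless oriented matroid on a finite ground set $E$, let $\mathbb{K}$ be a field, and let $\mathfrak{V}$ be the Varchenko matrix of $\mathcal{L}$ over $\mathbb{K}[U_e\mid e\in E]$. Then there exist nonnegative integers $b_F$ ($F\in\mathcal{L}$) such that $$\det(\mathfrak{V})=\prod_{F\in\mathcal{L}}\bigl(1-a(F)^2\bigr)^{b_F},$$ where $b_F=0$ if $F$ is a tope (in which case $1-a(F)^2=0$) and the convention $0^0=1$ is used.
   Context: Oriented matroids are given by their covector sets $\mathcal{L}\subseteq\{+,-,0\}^E$ (standard covector axioms). Covectors are ordered componentwise by $0<+$, $0<-$; the topes are the maximal covectors, and $\mathcal{T}$ is the set of topes. Loopless means that for every $e\in E$ some covector $X$ has $X_e\neq 0$; then every tope has all entries nonzero. For topes $P,Q$ put $\mathrm{Sep}(P,Q)=\{e\in E\mid P_e=-Q_e\neq 0\}$. The Varchenko matrix $\mathfrak{V}$ is the matrix with rows and columns indexed by $\mathcal{T}$ (in a fixed linear order) with entries $\mathfrak{V}_{P,Q}=\prod_{e\in \mathrm{Sep}(P,Q)}U_e\in\mathbb{K}[U_e\mid e\in E]$ (so $\mathfrak{V}_{P,P}=1$). For $F\in\mathcal{L}$, $a(F)=\prod_{e\in E,\,F_e=0}U_e$ (an empty product is $1$). *)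

theory Defs
  imports "HOL-Library.Poly_Mapping" "Jordan_Normal_Form.Determinant"
begin

datatype sign = Neg | Zero | Pos

instantiation sign :: "{uminus, order}"
begin

fun uminus_sign :: "sign \<Rightarrow> sign" where
  "- Neg = Pos"
| "- Zero = Zero"
| "- Pos = Neg"

definition less_eq_sign :: "sign \<Rightarrow> sign \<Rightarrow> bool" where
  "s \<le> t \<longleftrightarrow> s = Zero \<or> s = t"

definition less_sign :: "sign \<Rightarrow> sign \<Rightarrow> bool" where
  "s < t \<longleftrightarrow> s = Zero \<and> t \<noteq> (Zero :: sign)"

instance
  by standard (auto simp: less_eq_sign_def less_sign_def)

end

text \<open>
  Negation and the order on sign vectors are the pointwise ones from the function type.
  A sign vector on a ground set \<open>E\<close> is a function that vanishes outside \<open>E\<close>, so that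
  equality of functions is equality of sign vectors, and \<open>E\<close> may be empty.
\<close>

type_synonym 'e sign_vector = "'e \<Rightarrow> sign"

definition sign_vectors :: "'e set \<Rightarrow> 'e sign_vector set" where
  "sign_vectors E = {X. \<forall>e. e \<notin> E \<longrightarrow> X e = Zero}"

definition compose :: "'e sign_vector \<Rightarrow> 'e sign_vector \<Rightarrow> 'e sign_vector" where
  "compose X Y = (\<lambda>e. if X e \<noteq> Zero then X e else Y e)"

definition Sep :: "'e set \<Rightarrow> 'e sign_vector \<Rightarrow> 'e sign_vector \<Rightarrow> 'e set" where
  "Sep E X Y = {e \<in> E. X e = - Y e \<and> - Y e \<noteq> Zero}"

locale oriented_matroid =
  fixes E :: "'e set" and L :: "'e sign_vector set"
  assumes finite_ground: "finite E"
    and covectors_subset: "L \<subseteq> sign_vectors E"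
    and zero_covector: "(\<lambda>_. Zero) \<in> L"
    and symmetry: "X \<in> L \<Longrightarrow> - X \<in> L"
    and composition: "X \<in> L \<Longrightarrow> Y \<in> L \<Longrightarrow> compose X Y \<in> L"
    and elimination: "X \<in> L \<Longrightarrow> Y \<in> L \<Longrightarrow> e \<in> Sep E X Y \<Longrightarrow>
      \<exists>Z\<in>L. Z e = Zero \<and> (\<forall>f \<in> E - Sep E X Y. Z f = compose X Y f)"

definition loopless :: "'e set \<Rightarrow> 'e sign_vector set \<Rightarrow> bool" where
  "loopless E L \<longleftrightarrow> (\<forall>e\<in>E. \<exists>X\<in>L. X e \<noteq> Zero)"

definition topes :: "'e sign_vector set \<Rightarrow> 'e sign_vector set" where
  "topes L = {T \<in> L. \<forall>X\<in>L. T \<le> X \<longrightarrow> X = T}"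

text \<open>
  Polynomials with coefficients in \<open>'k\<close> in variables indexed by \<open>'e\<close>: finitely supported
  maps from monomials, i.e. from finitely supported exponent vectors. Only variables
  indexed by the ground set are used below.
\<close>

type_synonym ('e, 'k) mpolynomial = "('e \<Rightarrow>\<^sub>0 nat) \<Rightarrow>\<^sub>0 'k"

definition U :: "'e \<Rightarrow> ('e, 'k::field) mpolynomial" where
  "U e = Poly_Mapping.single (Poly_Mapping.single e 1) 1"

text \<open>The list fixes the linear order on the topes that indexes rows and columns.\<close>

definition varchenko_matrix ::
    "'e set \<Rightarrow> 'e sign_vector list \<Rightarrow> ('e, 'k::field) mpolynomial mat" where
  "varchenko_matrix E Ts =
     mat (length Ts) (length Ts) (\<lambda>(i, j). \<Prod>e\<in>Sep E (Ts ! i) (Ts ! j). U e)"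

definition face_weight :: "'e set \<Rightarrow> 'e sign_vector \<Rightarrow> ('e, 'k::field) mpolynomial" where
  "face_weight E F = (\<Prod>e\<in>{e \<in> E. F e = Zero}. U e)"

end

theory Submission
  imports Defs
begin

text \<open>
  The determinant is computed by cutting the set of topes with one element after the other.
  For a sign vector \<open>Y\<close> let \<open>K\<close> be the set of topes above \<open>Y\<close>, so that \<open>Y = 0\<close> gives all topes,
  and write \<open>V\<close> for the Varchenko matrix with rows and columns restricted to \<open>K\<close>. If two topes
  of \<open>K\<close> differ at \<open>e\<close>, then \<open>V = B M\<close>, where \<open>B\<close> keeps the entries of \<open>V\<close> at pairs of topes
  with the same sign at \<open>e\<close>. Hence \<open>det V\<close> is \<open>det M\<close> times the determinants of the two smaller
  matrices of the same kind that belong to the topes of \<open>K\<close> with a prescribed sign at \<open>e\<close>.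
  Induction on \<open>card K\<close> then reduces the theorem to \<open>det M\<close> (\<open>gdet_vweight_cone\<close>).

  The matrix \<open>M\<close> comes from an Euler relation. Every oriented matroid carries an integer weight
  \<open>w\<close> on covectors whose sum over each nonempty set of covectors of the form
  \<open>{F. Y \<le> F}\<close> is \<open>1\<close> (\<open>euler_weight_exists\<close>). In a hyperplane arrangement
  this sum is, up to sign, the Euler characteristic with compact support of a relatively open convex
  cone, and \<open>w F\<close> is \<open>1\<close> or \<open>-1\<close> according to the parity of the codimension of \<open>F\<close>. Take \<open>w\<close> for the contraction, that is, for the covectors
  \<open>F\<close> with \<open>F e = 0\<close>. If \<open>P\<close> and \<open>Q\<close> are topes of \<open>K\<close> on different sides of \<open>e\<close>, then
  \<open>V P Q = (\<Sum>F. w F * V P (F \<circ> -Q) * V (F \<circ> -Q) Q)\<close>: the product \<open>V P R * V R Q\<close> is \<open>V P Q\<close> times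
  the squares of the variables of all elements that separate \<open>R\<close> from both \<open>P\<close> and \<open>Q\<close>, and once
  these squares are expanded around \<open>1\<close>, the Euler relation makes all the additional terms cancel
  (\<open>vweight_expansion\<close>, through \<open>sum_weighted_product\<close>). So \<open>M R Q\<close> is the identity
  plus \<open>c R Q * V R Q\<close>, where \<open>c R Q\<close> is the sum of \<open>w F\<close> over all \<open>F\<close> with \<open>F \<circ> -Q = R\<close>.

  To evaluate \<open>det M\<close>, let \<open>G Q\<close> be the largest covector below \<open>Q\<close> that vanishes at \<open>e\<close>. If
  \<open>c R Q\<close> is nonzero, the support of \<open>G Q\<close> is contained in that of \<open>G R\<close>
  (\<open>coeff_nonzero_supports\<close>), and if the two supports agree, another instance of the Euler
  relation shows that \<open>G R = G Q\<close>, \<open>R = G Q \<circ> -Q\<close> and \<open>c R Q = \<plusminus>1\<close> (\<open>coeff_same_support\<close>).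
  Therefore \<open>M\<close> is block triangular, and its diagonal blocks are trivial or belong to
  a pair of topes \<open>Q\<close> and \<open>G Q \<circ> -Q\<close>. These two topes are separated exactly by the zeros of \<open>G Q\<close>, so
  the block has determinant \<open>1 - a(G Q)\<^sup>2\<close> (\<open>gdet_matching\<close>, \<open>gdet_transition\<close>).
\<close>

section \<open>Determinants indexed by finite sets\<close>

text \<open>
  Leibniz' formula over an arbitrary finite index set, so that restricting a matrix to a set of
  topes needs no renumbering.
\<close>

definition gdet :: "'i set \<Rightarrow> ('i \<Rightarrow> 'i \<Rightarrow> 'r) \<Rightarrow> 'r::comm_ring_1" where
  "gdet A f = (\<Sum>p | p permutes A. of_int (sign p) * (\<Prod>i\<in>A. f i (p i)))"

lemma gdet_cong:
  assumes "A = B" and "\<And>i j. i \<in> B \<Longrightarrow> j \<in> B \<Longrightarrow> f i j = g i j"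
  shows "gdet A f = gdet B g"
  unfolding gdet_def assms(1)
  by (intro sum.cong refl arg_cong2[of _ _ _ _ "(*)"] prod.cong) (auto intro: assms(2) simp: permutes_in_image)

lemma det_eq_gdet:
  assumes "distinct xs"
  shows "det (mat (length xs) (length xs) (\<lambda>(i, j). f (xs ! i) (xs ! j))) = gdet (set xs) f"
proof -
  let ?n = "length xs"
  let ?N = "{0..<?n}"
  have bij: "bij_betw ((!) xs) ?N (set xs)"
    by (intro bij_betw_nth assms) auto
  define idx where "idx = inv_into ?N ((!) xs)"
  have bij': "bij_betw idx (set xs) ?N"
    unfolding idx_def by (rule bij_betw_inv_into[OF bij])
  have idx1: "idx (xs ! i) = i" if "i \<in> ?N" for i
    unfolding idx_def by (rule inv_into_f_f) (use bij that in \<open>auto simp: bij_betw_def\<close>)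
  have idx2: "xs ! (idx x) = x" if "x \<in> set xs" for x
    unfolding idx_def by (rule f_inv_into_f) (use bij that in \<open>auto simp: bij_betw_def\<close>)
  have inj: "inj_on ((!) xs) ?N" using bij by (auto simp: bij_betw_def)
  have "det (mat ?n ?n (\<lambda>(i, j). f (xs ! i) (xs ! j))) =
    (\<Sum>p | p permutes ?N. of_int (sign p) * (\<Prod>i\<in>?N. f (xs ! i) (xs ! p i)))"
  proof (subst det_def'[of _ ?n], goal_cases)
    case 2
    have "p i < ?n" if "p permutes ?N" "i < ?n" for p i
      using permutes_in_image[OF that(1), of i] that(2) by simp
    then show ?case by (intro sum.cong refl arg_cong2[of _ _ _ _ "(*)"] prod.cong) auto
  qed simp
  also have "\<dots> = gdet (set xs) f"
    unfolding gdet_def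
  proof (rule sum.reindex_bij_witness[of _ "map_permutation (set xs) idx" "map_permutation ?N ((!) xs)"], goal_cases)
    case (1 p)
    then show ?case by (auto intro!: map_permutation_compose_inv[OF bij] idx1)
  next
    case (2 p)
    then show ?case by (auto intro!: map_permutation_permutes[OF bij])
  next
    case (3 p)
    then show ?case by (auto intro!: map_permutation_compose_inv[OF bij'] idx2)
  next
    case (4 p)
    then show ?case by (auto intro!: map_permutation_permutes[OF bij'])
  next
    case (5 p)
    then have p: "p permutes ?N" by simp
    have "(\<Prod>i\<in>set xs. f i (map_permutation ?N ((!) xs) p i)) = (\<Prod>i\<in>?N. f (xs ! i) (xs ! p i))"
      unfolding prod.reindex_bij_betw[OF bij, symmetric]
      by (intro prod.cong refl) (simp add: map_permutation_apply[OF inj])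
    moreover have "sign (map_permutation ?N ((!) xs) p) = sign p"
      by (rule sign_map_permutation[OF inj p]) simp
    ultimately show ?case by simp
  qed
  finally show ?thesis .
qed

lemma gdet_mult:
  assumes "finite A"
  shows "gdet A (\<lambda>i k. \<Sum>j\<in>A. f i j * g j k) = gdet A f * gdet A g"
proof -
  obtain xs where xs: "distinct xs" "set xs = A"
    using finite_distinct_list[OF assms] by blast
  let ?n = "length xs"
  let ?M = "\<lambda>f. mat ?n ?n (\<lambda>(i, j). f (xs ! i) (xs ! j))"
  have bij: "bij_betw ((!) xs) {0..<?n} A"
    using xs by (intro bij_betw_nth) auto
  have "?M (\<lambda>i k. \<Sum>j\<in>A. f i j * g j k) = ?M f * ?M g"
    by (rule eq_matI) (auto simp: scalar_prod_def sum.reindex_bij_betw[OF bij, symmetric])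
  then have "det (?M (\<lambda>i k. \<Sum>j\<in>A. f i j * g j k)) = det (?M f) * det (?M g)"
    by (simp add: det_mult[of _ ?n])
  then show ?thesis
    using det_eq_gdet[OF xs(1), of "\<lambda>i k. \<Sum>j\<in>A. f i j * g j k"]
    by (simp add: det_eq_gdet[OF xs(1)] xs(2))
qed

text \<open>
  Finiteness turns \<open>p ` A \<subseteq> A\<close> into an equality, which forces \<open>p\<close> to preserve \<open>B\<close> as well.
\<close>
lemma permutes_Un_invariant:
  assumes fin: "finite A" "finite B" and disj: "A \<inter> B = {}"
    and p: "p permutes A \<union> B" "p ` A \<subseteq> A"
  shows "p ` A = A" "p ` B = B" "restrict_id p A permutes A" "restrict_id p B permutes B"
    "restrict_id p A \<circ> restrict_id p B = p"
proof -
  have inj: "inj p" using p by (auto simp: permutes_inj)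
  show A: "p ` A = A"
    using p inj fin by (intro card_subset_eq) (auto simp: card_image inj_on_subset)
  have "p ` (A \<union> B) = A \<union> B" using p(1) by (rule permutes_image)
  then have "A \<union> p ` B = A \<union> B" by (simp add: image_Un A)
  moreover have "A \<inter> p ` B = {}" using image_Int[OF inj, of A B] disj by (simp add: A)
  moreover have "X = B" if "A \<union> X = A \<union> B" "A \<inter> X = {}" for X
    using that disj by blast
  ultimately show B: "p ` B = B" by simp
  have bijs: "bij_betw p A A" "bij_betw p B B"
    using A B inj_on_subset[OF inj subset_UNIV] by (auto simp: bij_betw_def)
  show "restrict_id p A permutes A" "restrict_id p B permutes B"
    by (auto intro!: bij_imp_permutes bij_betw_restrict_id bijs)
  have "p x = x" if "x \<notin> A" "x \<notin> B" for x
    using permutes_not_in[OF p(1), of x] that by simp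
  then show "restrict_id p A \<circ> restrict_id p B = p"
    using B disj by (fastforce simp: fun_eq_iff restrict_id_def)
qed

text \<open>
  The block triangular rule: a permutation that moves some index from \<open>A\<close> to \<open>B\<close> picks a zero
  entry, and the remaining ones are pairs of a permutation of \<open>A\<close> and one of \<open>B\<close>.
\<close>
lemma gdet_Un:
  assumes fin: "finite A" "finite B" and disj: "A \<inter> B = {}"
    and zero: "\<And>a b. a \<in> A \<Longrightarrow> b \<in> B \<Longrightarrow> f a b = 0"
  shows "gdet (A \<union> B) f = gdet A f * gdet B f"
proof -
  let ?t = "\<lambda>A p. of_int (sign p) * (\<Prod>i\<in>A. f i (p i))"
  have "gdet (A \<union> B) f = (\<Sum>p | p permutes A \<union> B \<and> p ` A \<subseteq> A. ?t (A \<union> B) p)"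
    unfolding gdet_def
  proof (rule sum.mono_neutral_right, goal_cases)
    case 1
    then show ?case using fin by (simp add: finite_permutations)
  next
    case 3
    show ?case
    proof
      fix p assume "p \<in> {p. p permutes A \<union> B} - {p. p permutes A \<union> B \<and> p ` A \<subseteq> A}"
      then obtain a where a: "p permutes A \<union> B" "a \<in> A" "p a \<notin> A" by blast
      then have "p a \<in> B" using permutes_in_image[OF a(1), of a] by auto
      then have "f a (p a) = 0" using zero a by blast
      then have "(\<Prod>i\<in>A \<union> B. f i (p i)) = 0"
        using a fin by (intro prod_zero) auto
      then show "?t (A \<union> B) p = 0" by simp
    qed
  qed auto
  also have "\<dots> = (\<Sum>(q, r)\<in>{q. q permutes A} \<times> {r. r permutes B}. ?t A q * ?t B r)"
  proof (rule sum.reindex_bij_witness[of _ "\<lambda>(q, r). q \<circ> r" "\<lambda>p. (restrict_id p A, restrict_id p B)"], goal_cases)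
    case (1 p)
    then show ?case using permutes_Un_invariant(5)[OF fin disj] by auto
  next
    case (2 p)
    then show ?case using permutes_Un_invariant(3,4)[OF fin disj] by auto
  next
    case (3 qr)
    then obtain q r where qr: "qr = (q, r)" "q permutes A" "r permutes B" by auto
    have "(q \<circ> r) x = q x" if "x \<in> A" for x
      using that disj permutes_not_in[OF qr(3), of x] by (auto simp: disjoint_iff)
    moreover have "(q \<circ> r) x = r x" if "x \<in> B" for x
      using that disj permutes_in_image[OF qr(3), of x] permutes_not_in[OF qr(2), of "r x"] by auto
    ultimately show ?case
      using qr permutes_not_in[OF qr(2)] permutes_not_in[OF qr(3)] by (auto simp: fun_eq_iff restrict_id_def)
  next
    case (4 qr)
    then obtain q r where qr: "qr = (q, r)" "q permutes A" "r permutes B" by auto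
    have "q \<circ> r permutes A \<union> B"
      by (rule permutes_compose permutes_subset[OF qr(2)] permutes_subset[OF qr(3)] Un_upper1 Un_upper2)+
    moreover have "(q \<circ> r) x \<in> A" if "x \<in> A" for x
      using that disj permutes_not_in[OF qr(3), of x] permutes_in_image[OF qr(2), of x]
      by (auto simp: disjoint_iff)
    ultimately show ?case using qr by auto
  next
    case (5 p)
    then have p: "p permutes A \<union> B" "p ` A \<subseteq> A" by auto
    note perms = permutes_Un_invariant(3,4)[OF fin disj p]
    have "p = restrict_id p A \<circ> restrict_id p B"
      using permutes_Un_invariant(5)[OF fin disj p] by simp
    then have "sign p = sign (restrict_id p A) * sign (restrict_id p B)"
      using perms fin by (metis sign_compose permutation_permutes)
    moreover have "(\<Prod>i\<in>A \<union> B. f i (p i)) = (\<Prod>i\<in>A. f i (restrict_id p A i)) * (\<Prod>i\<in>B. f i (restrict_id p B i))"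
    proof -
      have "(\<Prod>i\<in>A. f i (p i)) = (\<Prod>i\<in>A. f i (restrict_id p A i))"
        "(\<Prod>i\<in>B. f i (p i)) = (\<Prod>i\<in>B. f i (restrict_id p B i))"
        by (simp_all add: restrict_id_def cong: prod.cong)
      then show ?thesis using fin disj by (simp add: prod.union_disjoint)
    qed
    ultimately show ?case by (simp add: algebra_simps)
  qed
  also have "\<dots> = gdet A f * gdet B f"
    unfolding gdet_def sum_product sum.cartesian_product by simp
  finally show ?thesis .
qed

lemma gdet_singleton: "gdet {a} f = f a a"
proof -
  have "{p. p permutes {a}} = {id}" by auto
  then show ?thesis by (simp add: gdet_def)
qed

lemma gdet_empty: "gdet {} f = 1"
  by (simp add: gdet_def)

lemma gdet_pair:
  assumes "a \<noteq> b"
  shows "gdet {a, b} f = f a a * f b b - f a b * f b a"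
proof -
  have "{p. p permutes {a, b}} = {id, transpose a b}"
    by (simp add: permutes_doubleton_iff set_eq_iff)
  moreover have "id \<noteq> transpose a b" using assms by (metis id_apply transpose_apply_first)
  ultimately show ?thesis
    using assms by (simp add: gdet_def sign_swap_id)
qed

text \<open>
  The height \<open>h\<close> makes the matrix block triangular, and the partial matching \<open>\<tau>\<close> cuts its diagonal
  blocks into pieces of size at most two. An index of maximal height, together with its partner
  if there is one, can be split off, because their columns vanish outside this set. The predicate
  \<open>good\<close> stands for any multiplicatively closed set that contains the determinants of the
  blocks; the partner of an index may lie outside \<open>A\<close>, and then the index forms a block of its own.
\<close>
lemma gdet_matching:
  fixes f :: "'i \<Rightarrow> 'i \<Rightarrow> 'r::comm_ring_1" and h :: "'i \<Rightarrow> nat"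
  assumes "finite A"
    and one: "good 1" and mult: "\<And>x y. good x \<Longrightarrow> good y \<Longrightarrow> good (x * y)"
    and diag: "\<And>Q. Q \<in> A \<Longrightarrow> f Q Q = 1"
    and off: "\<And>R Q. R \<in> A \<Longrightarrow> Q \<in> A \<Longrightarrow> R \<noteq> Q \<Longrightarrow> f R Q \<noteq> 0 \<Longrightarrow> h Q < h R \<or> R = \<tau> Q"
    and partner: "\<And>Q. Q \<in> A \<Longrightarrow> \<tau> Q \<in> A \<Longrightarrow> \<tau> (\<tau> Q) = Q \<and> \<tau> Q \<noteq> Q \<and> h (\<tau> Q) = h Q
      \<and> good (1 - f Q (\<tau> Q) * f (\<tau> Q) Q)"
  shows "good (gdet A f)"
  using assms(1) diag off partner
proof (induction A rule: finite_psubset_induct)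
  case (psubset A)
  show ?case
  proof (cases "A = {}")
    case True
    then show ?thesis using one by (simp add: gdet_empty)
  next
    case False
    then have "Max (h ` A) \<in> h ` A" using psubset.hyps(1) by simp
    then obtain Q where Q: "Q \<in> A" "h Q = Max (h ` A)" by auto
    then have hQ: "h R \<le> h Q" if "R \<in> A" for R using that psubset.hyps(1) by simp
    define B where "B = insert Q ({\<tau> Q} \<inter> A)"
    have B: "B \<subseteq> A" "B \<noteq> {}" "finite B" using Q(1) psubset.hyps(1) by (auto simp: B_def)
    have "gdet ((A - B) \<union> B) f = gdet (A - B) f * gdet B f"
    proof (rule gdet_Un)
      fix R S assume RS: "R \<in> A - B" "S \<in> B"
      show "f R S = 0"
      proof (rule ccontr)
        assume "f R S \<noteq> 0"
        then have "h S < h R \<or> R = \<tau> S" using psubset.prems(2)[of R S] RS B(1) by blast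
        moreover have "h S = h Q" using RS(2) psubset.prems(3)[OF Q(1)] by (auto simp: B_def)
        ultimately have "R = \<tau> S" using hQ[of R] RS(1) by auto
        then show False using RS psubset.prems(3)[OF Q(1)] Q(1) by (auto simp: B_def)
      qed
    qed (use B psubset.hyps(1) in auto)
    moreover have "(A - B) \<union> B = A" using B(1) by blast
    moreover have "good (gdet (A - B) f)"
      by (rule psubset.IH) (use B psubset.prems in auto)
    moreover have "good (gdet B f)"
    proof (cases "\<tau> Q \<in> A")
      case True
      then have "B = {Q, \<tau> Q}" by (auto simp: B_def)
      then show ?thesis
        using gdet_pair[of Q "\<tau> Q" f] psubset.prems(1)[OF Q(1)] psubset.prems(1)[OF True]
          psubset.prems(3)[OF Q(1) True] by (metis mult_1)
    next
      case False
      then have "B = {Q}" by (auto simp: B_def)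
      then show ?thesis using psubset.prems(1)[OF Q(1)] one by (simp add: gdet_singleton)
    qed
    ultimately show ?thesis using mult by simp
  qed
qed

section \<open>Euler weights of oriented matroids\<close>

lemma sign_vector_le_iff: "X \<le> Y \<longleftrightarrow> (\<forall>e. X e \<noteq> Zero \<longrightarrow> Y e = X e)" for X :: "'e sign_vector"
  by (auto simp: le_fun_def less_eq_sign_def)

lemma uminus_sign_eq_Zero_iff [simp]: "- s = Zero \<longleftrightarrow> s = Zero" for s :: sign
  by (cases s) auto

lemma uminus_sign_uminus [simp]: "- (- s) = s" for s :: sign
  by (cases s) auto

lemma uminus_sign_eq_iff [simp]: "- s = s \<longleftrightarrow> s = Zero" "s = - s \<longleftrightarrow> s = Zero" for s :: sign
  by (cases s; auto)+

lemma sign_eq_uminus: "s \<noteq> Zero \<Longrightarrow> t \<noteq> Zero \<Longrightarrow> s \<noteq> t \<Longrightarrow> s = - t" for s t :: sign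
  by (cases s; cases t) auto

lemma compose_apply: "compose X Y e = (if X e \<noteq> Zero then X e else Y e)"
  by (simp add: compose_def)

lemma le_compose: "X \<le> compose X Y"
  by (simp add: sign_vector_le_iff compose_apply)

definition cone :: "'e sign_vector set \<Rightarrow> 'e sign_vector \<Rightarrow> 'e sign_vector set" where
  "cone L Y = {F \<in> L. Y \<le> F}"

text \<open>
  The contraction of \<open>Z\<close>, kept on the same ground set: the elements of \<open>Z\<close> become loops.
\<close>
definition contraction :: "'e sign_vector set \<Rightarrow> 'e set \<Rightarrow> 'e sign_vector set" where
  "contraction L Z = {F \<in> L. \<forall>g\<in>Z. F g = Zero}"

text \<open>
  The weight plays the role of the sign \<open>(-1)^codim F\<close>. For a cone generated by a covector \<open>Y\<close>, the
  condition is the recursion of Moebius inversion on the poset \<open>L\<close>; what oriented matroids add is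
  that it extends to every sign vector \<open>Y\<close>, covector or not.
\<close>
definition euler_weight :: "'e sign_vector set \<Rightarrow> ('e sign_vector \<Rightarrow> int) \<Rightarrow> bool" where
  "euler_weight L w \<longleftrightarrow> (\<forall>Y. cone L Y \<noteq> {} \<longrightarrow> (\<Sum>F\<in>cone L Y. w F) = 1)"

text \<open>Moebius inversion: the weights are determined one after the other, from the top downwards.\<close>
lemma moebius_weight_exists:
  fixes A :: "'a::order set"
  assumes "finite A"
  shows "\<exists>w :: 'a \<Rightarrow> int. \<forall>F\<in>A. (\<Sum>G | G \<in> A \<and> F \<le> G. w G) = 1"
  using assms
proof (induction A rule: finite_psubset_induct)
  case (psubset A)
  show ?case
  proof (cases "A = {}")
    case False
    then obtain m where m: "m \<in> A" "\<And>x. x \<in> A \<Longrightarrow> x \<le> m \<Longrightarrow> x = m"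
      using finite_has_minimal[OF psubset.hyps(1)] by metis
    obtain w :: "'a \<Rightarrow> int" where w: "\<forall>F\<in>A - {m}. (\<Sum>G | G \<in> A - {m} \<and> F \<le> G. w G) = 1"
      using psubset.IH[of "A - {m}"] m(1) by blast
    define w' where "w' = w(m := 1 - (\<Sum>G | G \<in> A - {m} \<and> m \<le> G. w G))"
    have "(\<Sum>G | G \<in> A \<and> F \<le> G. w' G) = 1" if "F \<in> A" for F
    proof (cases "F = m")
      case True
      have "{G. G \<in> A \<and> F \<le> G} = insert m {G. G \<in> A - {m} \<and> m \<le> G}"
        using True m(1) by auto
      moreover have "(\<Sum>G | G \<in> A - {m} \<and> m \<le> G. w' G) = (\<Sum>G | G \<in> A - {m} \<and> m \<le> G. w G)"
        by (rule sum.cong) (auto simp: w'_def)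
      ultimately show ?thesis
        using psubset.hyps(1) by (simp add: w'_def)
    next
      case False
      have "{G. G \<in> A \<and> F \<le> G} = {G. G \<in> A - {m} \<and> F \<le> G}"
        using False m(2) that by auto
      then have "(\<Sum>G | G \<in> A \<and> F \<le> G. w' G) = (\<Sum>G | G \<in> A - {m} \<and> F \<le> G. w G)"
        by (intro sum.cong) (auto simp: w'_def)
      then show ?thesis using w that False by simp
    qed
    then show ?thesis by blast
  qed simp
qed

lemma finite_sign_vectors:
  assumes "finite E"
  shows "finite (sign_vectors E :: 'e sign_vector set)"
proof -
  have UNIV: "(UNIV :: sign set) = {Neg, Zero, Pos}"
    using sign.exhaust by auto
  have "finite {X. \<forall>e. (e \<in> E \<longrightarrow> X e \<in> (UNIV :: sign set)) \<and> (e \<notin> E \<longrightarrow> X e = Zero)}"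
    by (rule finite_set_of_finite_funs[OF assms]) (simp add: UNIV)
  then show ?thesis by (simp add: sign_vectors_def)
qed

context oriented_matroid
begin

lemma finite_covectors: "finite L"
  using finite_subset[OF covectors_subset finite_sign_vectors[OF finite_ground]] .

lemma in_ground: "X \<in> L \<Longrightarrow> X e \<noteq> Zero \<Longrightarrow> e \<in> E"
  using covectors_subset by (auto simp: sign_vectors_def)

lemma finite_cone: "finite (cone L Y)"
  by (simp add: cone_def finite_covectors)

lemma contraction_oriented_matroid: "oriented_matroid E (contraction L Z)"
proof
  show "finite E" by (rule finite_ground)
  show "contraction L Z \<subseteq> sign_vectors E" using covectors_subset by (auto simp: contraction_def)
  show "(\<lambda>_. Zero) \<in> contraction L Z" using zero_covector by (simp add: contraction_def)
  show "- X \<in> contraction L Z" if "X \<in> contraction L Z" for X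
    using that symmetry by (auto simp: contraction_def)
  show "compose X Y \<in> contraction L Z" if "X \<in> contraction L Z" "Y \<in> contraction L Z" for X Y
    using that composition by (auto simp: contraction_def compose_apply)
next
  fix X Y e assume XY: "X \<in> contraction L Z" "Y \<in> contraction L Z" "e \<in> Sep E X Y"
  then obtain F where F: "F \<in> L" "F e = Zero" "\<forall>f \<in> E - Sep E X Y. F f = compose X Y f"
    using elimination[of X Y e] by (auto simp: contraction_def)
  have "F g = Zero" if "g \<in> Z" for g
  proof (cases "g \<in> E")
    case True
    have "X g = Zero" "Y g = Zero" using XY that by (auto simp: contraction_def)
    then show ?thesis using F(3) True by (auto simp: Sep_def compose_apply)
  next
    case False
    then show ?thesis using in_ground[OF F(1)] by blast
  qed
  then show "\<exists>F\<in>contraction L Z. F e = Zero \<and> (\<forall>f \<in> E - Sep E X Y. F f = compose X Y f)"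
    using F by (auto simp: contraction_def)
qed

text \<open>Elimination stays in the cone, since two members of a cone agree on the support of \<open>Y\<close>.\<close>
lemma cone_eliminate:
  assumes "X \<in> cone L Y" "X' \<in> cone L Y" "X g \<noteq> Zero" "X' g = - X g"
  obtains F where "F \<in> cone L Y" "F g = Zero"
proof -
  have g: "g \<in> Sep E X X'"
    using assms in_ground[of X g] by (auto simp: Sep_def cone_def)
  obtain F where F: "F \<in> L" "F g = Zero" "\<forall>f \<in> E - Sep E X X'. F f = compose X X' f"
    using elimination[OF _ _ g] assms by (auto simp: cone_def)
  have "F f = Y f" if "Y f \<noteq> Zero" for f
  proof -
    have "X f = Y f" "X' f = Y f" using assms(1,2) that by (auto simp: cone_def sign_vector_le_iff)
    moreover from this have "f \<in> E" using that in_ground[of X f] assms(1) by (auto simp: cone_def)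
    ultimately show ?thesis using F(3) that by (auto simp: Sep_def compose_apply)
  qed
  then show thesis using F that by (auto simp: cone_def sign_vector_le_iff)
qed

lemma sum_cone_split:
  fixes w :: "'e sign_vector \<Rightarrow> int"
  assumes "Y g = Zero"
  shows "(\<Sum>F\<in>cone L Y. w F) = (\<Sum>F\<in>cone L (Y(g := Pos)). w F) + (\<Sum>F\<in>cone L (Y(g := Neg)). w F)
    + (\<Sum>F\<in>cone (contraction L {g}) Y. w F)"
proof -
  have part: "cone L Y = (cone L (Y(g := Pos)) \<union> cone L (Y(g := Neg))) \<union> cone (contraction L {g}) Y"
    (is "_ = (?P \<union> ?N) \<union> ?Z")
  proof (intro equalityI subsetI)
    fix F assume "F \<in> cone L Y"
    then show "F \<in> (?P \<union> ?N) \<union> ?Z"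
      by (cases "F g") (auto simp: cone_def contraction_def sign_vector_le_iff)
  next
    fix F assume "F \<in> (?P \<union> ?N) \<union> ?Z"
    then show "F \<in> cone L Y"
      using assms by (auto simp: cone_def contraction_def sign_vector_le_iff split: if_splits)
  qed
  have disj: "?P \<inter> ?N = {}" "(?P \<union> ?N) \<inter> ?Z = {}"
    by (auto simp: cone_def contraction_def sign_vector_le_iff split: if_splits)
  have fin: "finite ?P" "finite ?N" "finite ?Z"
    by (auto intro: finite_cone simp: cone_def contraction_def finite_covectors)
  show ?thesis
    unfolding part using fin disj by (simp add: sum.union_disjoint)
qed

text \<open>
  A covector vanishing at \<open>g\<close> can be pushed to both sides of \<open>g\<close>, unless \<open>g\<close> is a loop.
\<close>
lemma cone_upd_nonempty:
  assumes "F \<in> cone L Y" "F g = Zero" "X \<in> L" "X g \<noteq> Zero" "s \<noteq> Zero"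
  shows "cone L (Y(g := s)) \<noteq> {}"
proof -
  obtain X' where X': "X' \<in> L" "X' g = s"
    using assms sign_eq_uminus[of "X g" s] symmetry[of X] by (metis fun_Compl_def uminus_sign_uminus)
  have "compose F X' \<in> cone L (Y(g := s))"
    using assms X' composition[of F X'] by (auto simp: cone_def sign_vector_le_iff compose_apply)
  then show ?thesis by blast
qed

end

text \<open>
  Induction on the size of the cone, for all oriented matroids simultaneously. If the cone has
  covectors on both sides of \<open>g\<close>, then by elimination also some that vanish at \<open>g\<close>. The two open
  halves are smaller cones, each of sum \<open>1\<close>. On the part vanishing at \<open>g\<close>, which is a smaller cone of
  the contraction, \<open>- w\<close> again satisfies the recursion (\<open>1 - 1 - 1 = -1\<close>), so its sum is \<open>1\<close> and
  the total is \<open>1 + 1 - 1 = 1\<close>. If no element cuts the cone, it consists of a single covector.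
  The recursion is only assumed inside the cone, which is what is known about \<open>- w\<close> at this point.
\<close>
lemma sum_cone_eq_1:
  fixes w :: "'e sign_vector \<Rightarrow> int"
  assumes "oriented_matroid E L" "cone L Y \<noteq> {}"
    and "\<And>F. F \<in> cone L Y \<Longrightarrow> (\<Sum>G\<in>cone L F. w G) = 1"
  shows "(\<Sum>G\<in>cone L Y. w G) = 1"
  using assms
proof (induction "card (cone L Y)" arbitrary: L Y w rule: less_induct)
  case less
  interpret oriented_matroid E L by fact
  note moebius = less.prems(3)
  show ?case
  proof (cases "\<exists>g. \<exists>X\<in>cone L Y. \<exists>X'\<in>cone L Y. X g \<noteq> Zero \<and> X' g = - X g")
    case True
    then obtain g X X' where g: "X \<in> cone L Y" "X' \<in> cone L Y" "X g \<noteq> Zero" "X' g = - X g"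
      by blast
    then have Yg: "Y g = Zero" by (auto simp: cone_def sign_vector_le_iff)
    obtain X0 where X0: "X0 \<in> cone L Y" "X0 g = Zero"
      using cone_eliminate[OF g] .
    \<comment> \<open>Needed for \<open>F = Y\<close> and for the covectors \<open>F\<close> of the cone that vanish at \<open>g\<close>; \<open>X'\<close> witnesses
      that the smaller cone is a proper part of the original one, and that it is nonempty.\<close>
    have half: "(\<Sum>G\<in>cone L (F(g := s)). w G) = 1"
      if F: "Y \<le> F" "F \<le> X'" and X': "X' \<in> L" "X' g = Zero" and s: "s \<noteq> Zero" for F X' s
    proof (rule less.hyps)
      have Fg: "F g = Zero" using F X' by (auto simp: sign_vector_le_iff)
      then have "F \<le> F(g := s)" by (simp add: sign_vector_le_iff)
      then have sub: "cone L (F(g := s)) \<subseteq> cone L Y"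
        using F(1) by (auto simp: cone_def intro: order.trans)
      moreover have "X' \<in> cone L Y - cone L (F(g := s))"
        using F X' s by (auto simp: cone_def sign_vector_le_iff intro: order.trans)
      ultimately show "card (cone L (F(g := s))) < card (cone L Y)"
        by (intro psubset_card_mono finite_cone) blast
      show "(\<Sum>G\<in>cone L G'. w G) = 1" if "G' \<in> cone L (F(g := s))" for G'
        using that sub moebius by blast
      show "cone L (F(g := s)) \<noteq> {}"
        using cone_upd_nonempty[of X' F g X s] F X' g s by (auto simp: cone_def)
    qed (rule less.prems)
    let ?L = "contraction L {g}"
    have "(\<Sum>G\<in>cone ?L Y. - w G) = 1"
    proof (rule less.hyps)
      have "cone ?L Y \<subseteq> cone L Y" "X \<in> cone L Y - cone ?L Y"
        using g by (auto simp: cone_def contraction_def)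
      then show "card (cone ?L Y) < card (cone L Y)"
        by (intro psubset_card_mono finite_cone) blast
      show "cone ?L Y \<noteq> {}"
        using X0 by (auto simp: cone_def contraction_def)
      show "oriented_matroid E ?L" by (rule contraction_oriented_matroid)
      fix F assume "F \<in> cone ?L Y"
      then have F: "F \<in> cone L Y" "F g = Zero" and F': "Y \<le> F" "F \<le> F" "F \<in> L"
        by (auto simp: cone_def contraction_def)
      show "(\<Sum>G\<in>cone ?L F. - w G) = 1"
        using sum_cone_split[where Y = F and w = w, OF F(2)] half[OF F' F(2), of Pos] half[OF F' F(2), of Neg] moebius[OF F(1)]
        by (simp add: sum_negf)
    qed
    moreover have "(\<Sum>G\<in>cone L (Y(g := s)). w G) = 1" if "s \<noteq> Zero" for s
      using half[of Y X0 s] X0 that by (simp add: cone_def)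
    ultimately show ?thesis
      using sum_cone_split[where Y = Y and w = w, OF Yg] by (simp add: sum_negf)
  next
    case False
    obtain F where F: "F \<in> cone L Y" using less.prems(2) by blast
    have eq: "G = F" if G: "G \<in> cone L Y" for G
    proof
      fix g
      \<comment> \<open>Otherwise \<open>X\<close> and \<open>X' \<circ> -X\<close> lie on opposite sides of \<open>g\<close>, although \<open>X' g\<close> may be zero.\<close>
      have agree: "X' g = X g" if X: "X \<in> cone L Y" "X' \<in> cone L Y" "X g \<noteq> Zero" for X X'
      proof (rule ccontr)
        assume neq: "X' g \<noteq> X g"
        have "Y \<le> compose X' (- X)"
          using X le_compose[of X' "- X"] order.trans[of Y X'] by (simp add: cone_def)
        then have "compose X' (- X) \<in> cone L Y"
          using X composition[of X' "- X"] symmetry[of X] by (simp add: cone_def)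
        moreover have "compose X' (- X) g = - X g"
          using neq X(3) sign_eq_uminus[of "X' g" "X g"] by (simp add: compose_apply)
        ultimately show False using False X by blast
      qed
      show "G g = F g"
        using agree[OF F G] agree[OF G F] by (cases "F g = Zero") auto
    qed
    then have "cone L Y = {F}" using F by blast
    moreover have "cone L F = {F}"
    proof -
      have "cone L F \<subseteq> cone L Y" using F order.trans[of Y F] by (auto simp: cone_def)
      moreover have "F \<in> cone L F" using F by (simp add: cone_def)
      ultimately show ?thesis using eq by blast
    qed
    ultimately show ?thesis using moebius[OF F] by simp
  qed
qed

context oriented_matroid
begin

lemma euler_weight_exists: "\<exists>w. euler_weight L w"
proof -
  obtain w :: "'e sign_vector \<Rightarrow> int" where w: "\<forall>F\<in>L. (\<Sum>G | G \<in> L \<and> F \<le> G. w G) = 1"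
    using moebius_weight_exists[OF finite_covectors] by blast
  have "euler_weight L w"
    unfolding euler_weight_def
  proof (intro allI impI)
    fix Y assume "cone L Y \<noteq> {}"
    then show "(\<Sum>F\<in>cone L Y. w F) = 1"
    proof (rule sum_cone_eq_1[OF oriented_matroid_axioms])
      show "(\<Sum>G\<in>cone L F. w G) = 1" if "F \<in> cone L Y" for F
        using w that by (auto simp: cone_def)
    qed
  qed
  then show ?thesis by blast
qed

text \<open>
  The part of a cone that vanishes at \<open>g\<close> is what remains after removing both open halves, so its
  weight is \<open>1 - 1 - 1\<close>.
\<close>
lemma euler_weight_contract_element:
  assumes w: "euler_weight L w" and X: "X \<in> L" "X g \<noteq> Zero"
  shows "euler_weight (contraction L {g}) (\<lambda>F. - w F)"
  unfolding euler_weight_def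
proof (intro allI impI)
  fix Y assume "cone (contraction L {g}) Y \<noteq> {}"
  then obtain F where F: "F \<in> cone L Y" "F g = Zero" by (auto simp: cone_def contraction_def)
  then have Yg: "Y g = Zero" by (auto simp: cone_def sign_vector_le_iff)
  have "(\<Sum>F\<in>cone L (Y(g := s)). w F) = 1" if "s \<noteq> Zero" for s
    using w cone_upd_nonempty[OF F X that] by (simp add: euler_weight_def)
  moreover have "(\<Sum>F\<in>cone L Y. w F) = 1" using w F(1) by (auto simp: euler_weight_def)
  ultimately show "(\<Sum>F\<in>cone (contraction L {g}) Y. - w F) = 1"
    using sum_cone_split[where Y = Y and w = w, OF Yg] by (simp add: sum_negf)
qed

text \<open>
  Each element contracted flips the sign of the weight, unless it is a loop by then.
\<close>
lemma euler_weight_contraction: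
  assumes w: "euler_weight L w" and Z: "finite Z"
  shows "\<exists>\<epsilon>. (\<epsilon> = 1 \<or> \<epsilon> = -1) \<and> euler_weight (contraction L Z) (\<lambda>F. \<epsilon> * w F)"
  using Z
proof induction
  case empty
  have "contraction L {} = L" by (simp add: contraction_def)
  then show ?case using w by (intro exI[of _ 1]) simp
next
  case (insert g Z)
  then obtain \<epsilon> where e: "\<epsilon> = 1 \<or> \<epsilon> = -1" "euler_weight (contraction L Z) (\<lambda>F. \<epsilon> * w F)" by blast
  interpret Z: oriented_matroid E "contraction L Z" by (rule contraction_oriented_matroid)
  have ins: "contraction L (insert g Z) = contraction (contraction L Z) {g}"
    by (auto simp: contraction_def)
  show ?case
  proof (cases "\<exists>X\<in>contraction L Z. X g \<noteq> Zero")
    case True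
    then have "euler_weight (contraction L (insert g Z)) (\<lambda>F. - (\<epsilon> * w F))"
      using Z.euler_weight_contract_element[OF e(2)] ins by auto
    then show ?thesis using e(1) by (intro exI[of _ "- \<epsilon>"]) auto
  next
    case False
    then have "contraction L (insert g Z) = contraction L Z"
      unfolding ins by (auto simp: contraction_def)
    then show ?thesis using e by auto
  qed
qed

end

section \<open>Sums of products over a weighted family\<close>

text \<open>
  The weighted family behaves like a probability space in which all the events \<open>P g\<close> with \<open>g \<in> D\<close>,
  and their intersections, have measure \<open>1\<close>: for the purpose of such sums, \<open>P g\<close> may be taken to
  be always true. To see this, each factor is written as \<open>\<beta> g + (\<alpha> g - \<beta> g) * [P g F]\<close> and
  the product is expanded.
\<close>
lemma sum_weighted_product:
  fixes w :: "'a \<Rightarrow> int" and \<alpha> \<beta> :: "'b \<Rightarrow> 'r::comm_ring_1"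
  assumes "finite D" and "finite \<F>"
    and "\<And>C. C \<subseteq> D \<Longrightarrow> (\<Sum>F | F \<in> \<F> \<and> (\<forall>g\<in>C. P g F). w F) = 1"
  shows "(\<Sum>F\<in>\<F>. of_int (w F) * (\<Prod>g\<in>D. if P g F then \<alpha> g else \<beta> g)) = (\<Prod>g\<in>D. \<alpha> g)"
  using assms
proof (induction D arbitrary: \<F> rule: finite_induct)
  case empty
  have "(\<Sum>F\<in>\<F>. w F) = 1" using empty(2)[of "{}"] by simp
  then show ?case by (simp flip: of_int_sum)
next
  case (insert g D)
  let ?p = "\<lambda>F. of_int (w F) * (\<Prod>g\<in>D. if P g F then \<alpha> g else \<beta> g)"
  let ?G = "{F \<in> \<F>. P g F}"
  have "of_int (w F) * (\<Prod>g\<in>insert g D. if P g F then \<alpha> g else \<beta> g) =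
      \<beta> g * ?p F + (\<alpha> g - \<beta> g) * (if P g F then ?p F else 0)" for F
    using insert.hyps by (simp add: algebra_simps)
  then have "(\<Sum>F\<in>\<F>. of_int (w F) * (\<Prod>g\<in>insert g D. if P g F then \<alpha> g else \<beta> g)) =
      \<beta> g * (\<Sum>F\<in>\<F>. ?p F) + (\<alpha> g - \<beta> g) * (\<Sum>F\<in>?G. ?p F)"
    using insert.prems(1) by (simp add: sum.distrib sum_distrib_left sum.inter_filter)
  moreover have "(\<Sum>F\<in>\<F>. ?p F) = (\<Prod>g\<in>D. \<alpha> g)"
    by (rule insert.IH) (use insert.prems in auto)
  moreover have "(\<Sum>F\<in>?G. ?p F) = (\<Prod>g\<in>D. \<alpha> g)"
  proof (rule insert.IH)
    fix C assume "C \<subseteq> D"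
    then have "(\<Sum>F | F \<in> \<F> \<and> (\<forall>g\<in>insert g C. P g F). w F) = 1"
      by (intro insert.prems) auto
    then show "(\<Sum>F | F \<in> ?G \<and> (\<forall>g\<in>C. P g F). w F) = 1"
      by (simp add: conj_assoc)
  qed (use insert.prems in auto)
  ultimately show ?case using insert.hyps by (simp add: algebra_simps)
qed

lemma prod_indicator:
  assumes "finite A"
  shows "(\<Prod>g\<in>A. if P g then 1 else 0) = (if \<forall>g\<in>A. P g then 1 else (0::'r::comm_semiring_1))"
  using assms by induction auto

section \<open>Weights of pairs of topes\<close>

text \<open>The entry of the Varchenko matrix, as a product over all of \<open>E\<close> so that it can be compared factor by factor.\<close>
definition vweight :: "'e set \<Rightarrow> ('e \<Rightarrow> 'r) \<Rightarrow> 'e sign_vector \<Rightarrow> 'e sign_vector \<Rightarrow> 'r::comm_ring_1" where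
  "vweight E u P Q = (\<Prod>g\<in>E. if P g = Q g then 1 else u g)"

text \<open>
  For a face \<open>F\<close> of the tope \<open>Q\<close> this is the tope opposite to \<open>Q\<close> at \<open>F\<close>. It is used for arbitrary
  covectors \<open>F\<close>.
\<close>
definition reflect :: "'e sign_vector \<Rightarrow> 'e sign_vector \<Rightarrow> 'e sign_vector" where
  "reflect F Q = compose F (- Q)"

lemma reflect_apply: "reflect F Q g = (if F g \<noteq> Zero then F g else - Q g)"
  by (simp add: reflect_def compose_apply)

lemma vweight_self [simp]: "vweight E u P P = 1"
  by (simp add: vweight_def)

section \<open>Factorization along one element\<close>

locale loopless_oriented_matroid = oriented_matroid +
  assumes loopless: "loopless E L"
begin

lemma tope_covector: "T \<in> topes L \<Longrightarrow> T \<in> L"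
  by (simp add: topes_def)

lemma tope_nonzero:
  assumes T: "T \<in> topes L" and e: "e \<in> E"
  shows "T e \<noteq> Zero"
proof
  assume Te: "T e = Zero"
  obtain X where X: "X \<in> L" "X e \<noteq> Zero" using loopless e by (auto simp: loopless_def)
  have "compose T X = T"
    using T composition[OF _ X(1), of T] le_compose[of T X] unfolding topes_def by blast
  then have "T e = X e" using Te by (metis compose_apply)
  then show False using Te X by simp
qed

lemma tope_zero_iff: "T \<in> topes L \<Longrightarrow> T e = Zero \<longleftrightarrow> e \<notin> E"
  using tope_nonzero in_ground tope_covector by blast

lemma topeI:
  assumes X: "X \<in> L" and nz: "\<And>e. e \<in> E \<Longrightarrow> X e \<noteq> Zero"
  shows "X \<in> topes L"
proof -
  have "Y = X" if "Y \<in> L" "X \<le> Y" for Y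
  proof
    fix e
    show "Y e = X e"
      using that nz[of e] in_ground[OF that(1), of e] in_ground[OF X, of e]
      by (cases "Y e = Zero"; cases "X e = Zero") (auto simp: sign_vector_le_iff)
  qed
  then show ?thesis using X by (auto simp: topes_def)
qed

lemma finite_topes: "finite (topes L)"
  using finite_covectors by (simp add: topes_def)

lemma reflect_tope:
  assumes "F \<in> L" "Q \<in> topes L"
  shows "reflect F Q \<in> topes L"
proof (rule topeI)
  show "reflect F Q \<in> L"
    unfolding reflect_def using assms composition symmetry tope_covector by blast
  show "reflect F Q e \<noteq> Zero" if "e \<in> E" for e
    using tope_nonzero[OF assms(2) that] by (simp add: reflect_apply)
qed

text \<open>
  Going from \<open>P\<close> to \<open>Q\<close> through \<open>R = reflect F Q\<close>, exactly those elements are crossed twice that do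
  not separate \<open>P\<close> from \<open>Q\<close> but separate \<open>R\<close> from both; they contribute the squares.
\<close>
lemma vweight_reflect:
  assumes "P \<in> topes L" "Q \<in> topes L"
  shows "vweight E u P (reflect F Q) * vweight E u (reflect F Q) Q =
    vweight E u P Q * (\<Prod>g\<in>{g \<in> E. P g = Q g}. if F g = Q g then 1 else (u g)\<^sup>2)"
proof -
  show ?thesis
    unfolding vweight_def prod.inter_filter[OF finite_ground] prod.distrib[symmetric]
  proof (intro prod.cong refl, goal_cases)
    case (1 g)
    have "P g \<noteq> Zero" "Q g \<noteq> Zero" using assms tope_nonzero 1 by blast+
    then show ?case
      by (cases "P g"; cases "Q g"; cases "F g") (simp_all add: reflect_apply power2_eq_square)
  qed
qed

text \<open>
  By the preceding lemma, the sum is \<open>vweight E u P Q\<close> times a sum of products to which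
  \<open>sum_weighted_product\<close> applies. Its hypothesis is the Euler relation for the cones of the
  contraction on which the signs of \<open>Q\<close> are prescribed at elements not separating \<open>P\<close> from \<open>Q\<close>;
  they are nonempty because eliminating \<open>e\<close> between \<open>P\<close> and \<open>Q\<close> yields a covector in all of them.
\<close>
lemma vweight_expansion:
  assumes PQ: "P \<in> topes L" "Q \<in> topes L" "e \<in> E" "P e \<noteq> Q e" and Y: "Y \<le> P" "Y \<le> Q"
    and w: "euler_weight (contraction L {e}) w"
  shows "(\<Sum>F\<in>cone (contraction L {e}) Y.
      of_int (w F) * (vweight E u P (reflect F Q) * vweight E u (reflect F Q) Q)) = vweight E u P Q"
proof -
  let ?L = "contraction L {e}" and ?D = "{g \<in> E. P g = Q g}"
  have "P e = - Q e" using PQ tope_nonzero sign_eq_uminus by metis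
  then have "e \<in> Sep E P Q" using PQ tope_nonzero by (auto simp: Sep_def)
  then obtain Z where Z: "Z \<in> L" "Z e = Zero" "\<forall>f \<in> E - Sep E P Q. Z f = compose P Q f"
    using elimination PQ tope_covector by blast
  have ZD: "Z g = Q g" if "g \<in> ?D" for g
    using Z(3) that tope_nonzero[OF PQ(1)] by (auto simp: Sep_def compose_apply)
  have YD: "g \<in> ?D" if "Y g \<noteq> Zero" for g
    using Y that in_ground[of P g] tope_covector[OF PQ(1)] by (auto simp: sign_vector_le_iff)
  have "(\<Sum>F\<in>cone ?L Y. of_int (w F) * (\<Prod>g\<in>?D. if F g = Q g then 1 else (u g)\<^sup>2)) = (\<Prod>g\<in>?D. 1)"
  proof (rule sum_weighted_product)
    fix C assume C: "C \<subseteq> ?D"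
    let ?Y = "\<lambda>g. if g \<in> C then Q g else Y g"
    have eq: "{F. F \<in> cone ?L Y \<and> (\<forall>g\<in>C. F g = Q g)} = cone ?L ?Y"
    proof (intro equalityI subsetI CollectI conjI)
      fix F assume "F \<in> {F. F \<in> cone ?L Y \<and> (\<forall>g\<in>C. F g = Q g)}"
      then show "F \<in> cone ?L ?Y" by (auto simp: cone_def sign_vector_le_iff)
    next
      fix F assume F: "F \<in> cone ?L ?Y"
      then show CF: "\<forall>g\<in>C. F g = Q g"
        using C tope_nonzero[OF PQ(2)] by (auto simp: cone_def sign_vector_le_iff)
      show "F \<in> cone ?L Y"
        using F CF Y(2) by (auto simp: cone_def sign_vector_le_iff)
    qed
    have "Z \<in> cone ?L ?Y"
      using Z ZD C YD Y(2) by (auto simp: cone_def contraction_def sign_vector_le_iff)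
    then show "(\<Sum>F | F \<in> cone ?L Y \<and> (\<forall>g\<in>C. F g = Q g). w F) = 1"
      unfolding eq using w by (auto simp: euler_weight_def)
  qed (auto simp: finite_ground cone_def contraction_def finite_covectors)
  then have 1: "(\<Sum>F\<in>cone ?L Y. of_int (w F) * (\<Prod>g\<in>?D. if F g = Q g then 1 else (u g)\<^sup>2)) = 1"
    by simp
  have "(\<Sum>F\<in>cone ?L Y. of_int (w F) * (vweight E u P (reflect F Q) * vweight E u (reflect F Q) Q)) =
    vweight E u P Q * (\<Sum>F\<in>cone ?L Y. of_int (w F) * (\<Prod>g\<in>?D. if F g = Q g then 1 else (u g)\<^sup>2))"
    unfolding vweight_reflect[OF PQ(1,2)] sum_distrib_left by (simp add: algebra_simps)
  then show ?thesis using 1 by simp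
qed

definition coeff :: "'a \<Rightarrow> ('a sign_vector \<Rightarrow> int) \<Rightarrow> 'a sign_vector \<Rightarrow> 'a sign_vector \<Rightarrow> int" where
  "coeff e w R Q = (\<Sum>F | F \<in> contraction L {e} \<and> reflect F Q = R. w F)"

lemma coeff_nonzeroE:
  assumes "coeff e w R Q \<noteq> 0"
  obtains F where "F \<in> L" "F e = Zero" "reflect F Q = R"
proof -
  have "{F. F \<in> contraction L {e} \<and> reflect F Q = R} \<noteq> {}"
    using assms unfolding coeff_def by (metis sum.empty)
  then show thesis using that by (auto simp: contraction_def)
qed

text \<open>
  The second factor in the factorization of the Varchenko matrix: it expresses a column on one side
  of \<open>e\<close> through the columns on the other side.
\<close>
definition transition :: "('a \<Rightarrow> 'r) \<Rightarrow> 'a \<Rightarrow> ('a sign_vector \<Rightarrow> int) \<Rightarrow> 'a sign_vector \<Rightarrow> 'a sign_vector \<Rightarrow> 'r::comm_ring_1" where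
  "transition u e w R Q = (if R = Q then 1 else 0) + of_int (coeff e w R Q) * vweight E u R Q"

text \<open>
  Grouping the covectors \<open>F\<close> in \<open>vweight_expansion\<close> by \<open>R = reflect F Q\<close> turns the sum into a
  matrix product. Only covectors above \<open>Y\<close> contribute to rows \<open>R\<close> in \<open>K\<close>: \<open>R\<close> and \<open>Q\<close> agree on the
  support of \<open>Y\<close>, whereas they differ wherever \<open>F\<close> vanishes. So the coefficients need not refer to \<open>K\<close>.
\<close>
lemma vweight_factorization:
  assumes e: "e \<in> E" and w: "euler_weight (contraction L {e}) w"
    and K: "K = {T \<in> topes L. Y \<le> T}" and PQ: "P \<in> K" "Q \<in> K"
  shows "vweight E u P Q = (\<Sum>R\<in>K. (if P e = R e then vweight E u P R else 0) * transition u e w R Q)"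
proof -
  let ?L = "contraction L {e}"
  let ?c = "\<lambda>R. of_int (coeff e w R Q)"
  have finK: "finite K" using K finite_topes by simp
  have tP: "P \<in> topes L" and tQ: "Q \<in> topes L" and YP: "Y \<le> P" and YQ: "Y \<le> Q" using K PQ by auto
  have opposite: "R e = - Q e" if "coeff e w R Q \<noteq> 0" for R
    using coeff_nonzeroE[OF that] by (metis reflect_apply)
  have Qe: "Q e \<noteq> Zero" using tope_nonzero[OF tQ e] .
  have "(\<Sum>R\<in>K. (if P e = R e then vweight E u P R else 0) * transition u e w R Q) =
    (\<Sum>R\<in>K. if R = Q then if P e = R e then vweight E u P R else 0 else 0) +
    (\<Sum>R\<in>K. (if P e = R e then ?c R * (vweight E u P R * vweight E u R Q) else 0))"
    unfolding transition_def sum.distrib[symmetric] by (intro sum.cong) (auto simp: algebra_simps)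
  also have "(\<Sum>R\<in>K. if R = Q then if P e = R e then vweight E u P R else 0 else 0) =
    (if P e = Q e then vweight E u P Q else 0)"
    using finK PQ by simp
  also have "\<dots> + (\<Sum>R\<in>K. (if P e = R e then ?c R * (vweight E u P R * vweight E u R Q) else 0)) = vweight E u P Q"
  proof (cases "P e = Q e")
    case True
    have "(if P e = R e then ?c R * (vweight E u P R * vweight E u R Q) else 0) = 0" for R
      using opposite[of R] True Qe by (cases "coeff e w R Q = 0") auto
    then show ?thesis using True by simp
  next
    case False
    have "P e = - Q e" using False Qe tope_nonzero[OF tP e] sign_eq_uminus by blast
    then have "(if P e = R e then ?c R * (vweight E u P R * vweight E u R Q) else 0) =
        ?c R * (vweight E u P R * vweight E u R Q)" for R
      using opposite[of R] by (cases "coeff e w R Q = 0") auto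
    then have "(\<Sum>R\<in>K. (if P e = R e then ?c R * (vweight E u P R * vweight E u R Q) else 0)) =
        (\<Sum>R\<in>K. ?c R * (vweight E u P R * vweight E u R Q))" by simp
    also have "\<dots> = (\<Sum>R\<in>K. \<Sum>F | F \<in> cone ?L Y \<and> reflect F Q = R.
        of_int (w F) * (vweight E u P (reflect F Q) * vweight E u (reflect F Q) Q))"
    proof (rule sum.cong)
      fix R assume R: "R \<in> K"
      have "{F. F \<in> ?L \<and> reflect F Q = R} = {F. F \<in> cone ?L Y \<and> reflect F Q = R}"
      proof -
        have "Y \<le> F" if "reflect F Q = R" for F
          unfolding sign_vector_le_iff
        proof (intro allI impI)
          fix g assume g: "Y g \<noteq> Zero"
          then have "R g = Y g" "Q g = Y g" using R YQ K by (auto simp: sign_vector_le_iff)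
          then show "F g = Y g" using that g by (metis reflect_apply uminus_sign_eq_iff(1))
        qed
        then show ?thesis by (auto simp: cone_def)
      qed
      then show "?c R * (vweight E u P R * vweight E u R Q) =
        (\<Sum>F | F \<in> cone ?L Y \<and> reflect F Q = R.
          of_int (w F) * (vweight E u P (reflect F Q) * vweight E u (reflect F Q) Q))"
        by (simp add: coeff_def sum_distrib_right)
    qed simp
    also have "\<dots> = (\<Sum>F\<in>cone ?L Y.
        of_int (w F) * (vweight E u P (reflect F Q) * vweight E u (reflect F Q) Q))"
    proof (rule sum.group[OF _ finK])
      show "finite (cone ?L Y)" by (simp add: cone_def contraction_def finite_covectors)
      show "(\<lambda>F. reflect F Q) ` cone ?L Y \<subseteq> K"
      proof
        fix R assume "R \<in> (\<lambda>F. reflect F Q) ` cone ?L Y"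
        then obtain F where F: "F \<in> L" "Y \<le> F" "R = reflect F Q" by (auto simp: cone_def contraction_def)
        then have "Y \<le> R" using order.trans[OF F(2) le_compose] by (simp add: reflect_def)
        then show "R \<in> K" using F reflect_tope[OF F(1) tQ] K by simp
      qed
    qed
    also have "\<dots> = vweight E u P Q"
      by (rule vweight_expansion[OF tP tQ e False YP YQ w])
    finally show ?thesis using False by simp
  qed
  finally show ?thesis by simp
qed

section \<open>The determinant of the transition matrix\<close>

text \<open>Faces of \<open>Q\<close> are closed under composition, so a maximal one is the greatest.\<close>
lemma max_face_exists:
  "\<exists>G\<in>contraction L {e}. G \<le> Q \<and> (\<forall>F\<in>contraction L {e}. F \<le> Q \<longrightarrow> F \<le> G)"
proof -
  let ?A = "{F \<in> contraction L {e}. F \<le> Q}"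
  have "(\<lambda>_. Zero) \<in> ?A" using zero_covector by (simp add: contraction_def sign_vector_le_iff)
  moreover have "finite ?A" using finite_covectors by (simp add: contraction_def)
  ultimately obtain G where G: "G \<in> ?A" "\<And>F. F \<in> ?A \<Longrightarrow> G \<le> F \<Longrightarrow> F = G"
    using finite_has_maximal[of ?A] by blast
  have "F \<le> G" if F: "F \<in> ?A" for F
    unfolding sign_vector_le_iff
  proof (intro allI impI)
    fix g assume g: "F g \<noteq> Zero"
    have "compose G F \<in> ?A"
      using F G(1) composition by (auto simp: contraction_def sign_vector_le_iff compose_apply)
    then have "compose G F = G" using G(2) le_compose by blast
    then have "G g \<noteq> Zero" using g by (metis compose_apply)
    then show "G g = F g" using F G(1) g by (auto simp: sign_vector_le_iff)
  qed
  then show ?thesis using G(1) by blast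
qed

definition max_face :: "'a \<Rightarrow> 'a sign_vector \<Rightarrow> 'a sign_vector" where
  "max_face e Q = (SOME G. G \<in> contraction L {e} \<and> G \<le> Q \<and> (\<forall>F\<in>contraction L {e}. F \<le> Q \<longrightarrow> F \<le> G))"

lemma max_face:
  "max_face e Q \<in> L" "max_face e Q e = Zero" "max_face e Q \<le> Q"
  "F \<in> L \<Longrightarrow> F e = Zero \<Longrightarrow> F \<le> Q \<Longrightarrow> F \<le> max_face e Q"
proof -
  have "max_face e Q \<in> contraction L {e} \<and> max_face e Q \<le> Q \<and>
      (\<forall>F\<in>contraction L {e}. F \<le> Q \<longrightarrow> F \<le> max_face e Q)"
    using someI_ex[OF max_face_exists[of e Q, unfolded Bex_def]] unfolding max_face_def .
  then show "max_face e Q \<in> L" "max_face e Q e = Zero" "max_face e Q \<le> Q"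
    "F \<in> L \<Longrightarrow> F e = Zero \<Longrightarrow> F \<le> Q \<Longrightarrow> F \<le> max_face e Q"
    by (auto simp: contraction_def)
qed

text \<open>
  If \<open>R = reflect F Q\<close>, then \<open>F\<close> is a face of \<open>R\<close>. With \<open>H\<close> the greatest face of \<open>Q\<close> vanishing at \<open>e\<close>,
  \<open>F \<circ> -H\<close> is a face of \<open>R\<close> as well, hence below the greatest one.
\<close>
lemma coeff_nonzero_supports:
  assumes "coeff e w R Q \<noteq> 0"
  shows "\<And>g. max_face e Q g \<noteq> Zero \<Longrightarrow> max_face e R g \<noteq> Zero"
    and "R = reflect (max_face e R) Q"
proof -
  let ?G = "max_face e R" and ?H = "max_face e Q"
  obtain F where F: "F \<in> L" "F e = Zero" "reflect F Q = R" using coeff_nonzeroE[OF assms] .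
  have "F \<le> R" using F(3) le_compose by (auto simp: reflect_def)
  then have FG: "F \<le> ?G" using F max_face(4) by blast
  have "compose F (- ?H) \<le> R"
    using max_face(3)[of e Q] F(3)[symmetric]
    by (auto simp: sign_vector_le_iff compose_apply reflect_apply)
  then have le: "compose F (- ?H) \<le> ?G"
    using F max_face(1,2)[of e Q] composition symmetry
    by (intro max_face(4)) (auto simp: compose_apply)
  show "?G g \<noteq> Zero" if "?H g \<noteq> Zero" for g
  proof -
    have "compose F (- ?H) g \<noteq> Zero" using that by (cases "F g = Zero") (simp_all add: compose_apply)
    then show ?thesis using le by (simp add: sign_vector_le_iff)
  qed
  show "R = reflect ?G Q"
  proof
    fix g
    show "R g = reflect ?G Q g"
      using FG F(3)[symmetric] max_face(3)[of e R]
      by (cases "?G g = Zero") (auto simp: sign_vector_le_iff reflect_apply)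
  qed
qed

lemma coeff_diagonal:
  assumes "Q \<in> topes L" "e \<in> E"
  shows "coeff e w Q Q = 0"
proof (rule ccontr)
  assume "coeff e w Q Q \<noteq> 0"
  then obtain F where "F e = Zero" "reflect F Q = Q" by (rule coeff_nonzeroE)
  then have "Q e = - Q e" by (metis reflect_apply)
  then show False using tope_nonzero[OF assms] by simp
qed

text \<open>
  The reflection at the greatest face vanishing at \<open>e\<close> is an involution: if the reflected tope had a
  larger face \<open>G'\<close> of this kind, then \<open>G \<circ> -G'\<close> would be a face of \<open>Q\<close> larger than \<open>G\<close>.
\<close>
lemma max_face_reflect:
  shows "max_face e (reflect (max_face e Q) Q) = max_face e Q"
    and "reflect (max_face e Q) (reflect (max_face e Q) Q) = Q"
proof -
  let ?G = "max_face e Q" let ?G' = "max_face e (reflect ?G Q)"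
  have 1: "?G \<le> ?G'"
    using max_face(1,2)[of e Q] le_compose by (intro max_face(4)) (auto simp: reflect_def)
  have "compose ?G (- ?G') \<le> Q"
    unfolding sign_vector_le_iff
  proof (intro allI impI)
    fix g assume "compose ?G (- ?G') g \<noteq> Zero"
    then show "Q g = compose ?G (- ?G') g"
      using max_face(3)[of e Q] max_face(3)[of e "reflect ?G Q"]
      by (cases "?G g = Zero") (auto simp: sign_vector_le_iff compose_apply reflect_apply, metis uminus_sign_uminus)
  qed
  then have 2: "compose ?G (- ?G') \<le> ?G"
    using max_face(1,2)[of e Q] max_face(1,2)[of e "reflect ?G Q"] composition symmetry
    by (intro max_face(4)) (auto simp: compose_apply)
  show "?G' = ?G"
  proof
    fix g
    have "compose ?G (- ?G') g = - ?G' g" if "?G g = Zero" using that by (simp add: compose_apply)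
    then show "?G' g = ?G g"
      using 1 2 by (metis sign_vector_le_iff uminus_sign_eq_Zero_iff)
  qed
  show "reflect ?G (reflect ?G Q) = Q"
    using max_face(3)[of e Q] by (auto simp: fun_eq_iff sign_vector_le_iff reflect_apply)
qed

definition zeros :: "'a sign_vector \<Rightarrow> 'a set" where
  "zeros F = {g \<in> E. F g = Zero}"

text \<open>
  Let \<open>G\<close> and \<open>H\<close> be the greatest faces of \<open>R\<close> and \<open>Q\<close>, both with zero set \<open>Z\<close>. The covectors \<open>F\<close>
  contributing to the coefficient vanish on \<open>Z\<close>, and outside \<open>Z\<close> they agree with \<open>H\<close> exactly where
  \<open>G\<close> does. Up to the sign \<open>\<epsilon>\<close>, \<open>w\<close> is an Euler weight on the contraction of \<open>Z\<close>, and there the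
  events \<open>F g = H g\<close> satisfy the hypothesis of \<open>sum_weighted_product\<close>. So the weight of the
  contributing covectors is as if \<open>F\<close> always agreed with \<open>H\<close>: it is zero unless \<open>G = H\<close>. That the same
  \<open>\<epsilon>\<close> serves all pairs with zero set \<open>Z\<close> matters because the coefficients of both directions of a
  matched pair are multiplied.
\<close>
lemma coeff_same_support:
  assumes w: "euler_weight (contraction L {e}) w"
  shows "\<exists>\<epsilon>. (\<epsilon> = 1 \<or> \<epsilon> = -1) \<and> (\<forall>R\<in>topes L. \<forall>Q\<in>topes L.
    zeros (max_face e R) = Z \<longrightarrow> zeros (max_face e Q) = Z \<longrightarrow> R = reflect (max_face e R) Q \<longrightarrow>
    coeff e w R Q = (if max_face e R = max_face e Q then \<epsilon> else 0))"
proof (cases "Z \<subseteq> E")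
  case False
  then show ?thesis by (intro exI[of _ 1]) (auto simp: zeros_def)
next
  case True
  then have finZ: "finite Z" using finite_ground finite_subset by blast
  interpret e: oriented_matroid E "contraction L {e}" by (rule contraction_oriented_matroid)
  let ?L = "contraction (contraction L {e}) Z"
  obtain \<epsilon> where \<epsilon>: "\<epsilon> = 1 \<or> \<epsilon> = -1" and w': "euler_weight ?L (\<lambda>F. \<epsilon> * w F)"
    using e.euler_weight_contraction[OF w finZ] by blast
  have "coeff e w R Q = (if max_face e R = max_face e Q then \<epsilon> else 0)"
    if R: "R \<in> topes L" "zeros (max_face e R) = Z" and Q: "Q \<in> topes L" "zeros (max_face e Q) = Z"
      and RQ: "R = reflect (max_face e R) Q" for R Q
  proof -
    define G where "G = max_face e R"
    define H where "H = max_face e Q"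
    have zG: "G g = Zero \<longleftrightarrow> g \<in> Z" and zH: "H g = Zero \<longleftrightarrow> g \<in> Z" if "g \<in> E" for g
      using R(2) Q(2) that by (auto simp: G_def H_def zeros_def)
    have offG: "G g = Zero" and offH: "H g = Zero" and offQ: "Q g = Zero" if "g \<notin> E" for g
      using that in_ground max_face(1) tope_covector[OF Q(1)] by (auto simp: G_def H_def)
    have HQ: "Q g = H g" if "g \<in> E - Z" for g
      using that zH max_face(3)[of e Q] by (auto simp: H_def sign_vector_le_iff)
    have RQ': "R g = (if G g \<noteq> Zero then G g else - Q g)" for g
      using RQ by (metis G_def reflect_apply)
    have L: "F \<in> ?L \<longleftrightarrow> F \<in> L \<and> F e = Zero \<and> (\<forall>g\<in>Z. F g = Zero)" for F
      by (auto simp: contraction_def)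
    let ?P = "\<lambda>F g. (F g = H g) = (G g = H g)"
    have eq: "{F. F \<in> contraction L {e} \<and> reflect F Q = R} = {F \<in> ?L. \<forall>g\<in>E - Z. ?P F g}"
    proof (intro equalityI subsetI CollectI conjI ballI)
      fix F assume F: "F \<in> {F. F \<in> contraction L {e} \<and> reflect F Q = R}"
      then have F': "F \<in> L" "F e = Zero" and r: "\<And>g. R g = (if F g \<noteq> Zero then F g else - Q g)"
        by (auto simp: contraction_def reflect_apply)
      have "F \<le> R" using r by (simp add: sign_vector_le_iff)
      then have FG: "F \<le> G" unfolding G_def using F' by (intro max_face(4)) auto
      then show "F \<in> ?L"
        using F' zG True unfolding L sign_vector_le_iff by (metis subsetD)
      fix g assume g: "g \<in> E - Z"
      then show "?P F g"
        using r[of g] RQ'[of g] HQ[OF g] zG[of g] zH[of g] by (cases "F g = Zero") auto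
    next
      fix F assume F: "F \<in> {F \<in> ?L. \<forall>g\<in>E - Z. ?P F g}"
      then have F': "F \<in> L" "F e = Zero" "\<And>g. g \<in> Z \<Longrightarrow> F g = Zero" "\<And>g. g \<in> E - Z \<Longrightarrow> ?P F g"
        unfolding L by auto
      show "F \<in> contraction L {e}" using F' by (simp add: contraction_def)
      show "reflect F Q = R"
      proof
        fix g
        consider "g \<in> Z" | "g \<notin> E" | "g \<in> E - Z" by blast
        then show "reflect F Q g = R g"
        proof cases
          case 1
          then show ?thesis using F'(3) RQ' zG True by (auto simp: reflect_apply)
        next
          case 2
          then show ?thesis using offG offQ RQ' in_ground[OF F'(1)] by (auto simp: reflect_apply)
        next
          case 3
          then show ?thesis
            using F'(4)[of g] RQ'[of g] HQ[OF 3] zG[of g] zH[of g]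
            by (cases "F g"; cases "G g"; cases "H g") (simp_all add: reflect_apply)
        qed
      qed
    qed
    \<comment> \<open>The product over \<open>E - Z\<close> is the indicator of the covectors that contribute to the coefficient.\<close>
    have "(\<Sum>F\<in>?L. of_int (\<epsilon> * w F) * (\<Prod>g\<in>E - Z. if F g = H g then (if G g = H g then 1 else 0) else (if G g \<noteq> H g then 1 else 0)))
      = (\<Prod>g\<in>E - Z. if G g = H g then 1 else (0::int))"
    proof (rule sum_weighted_product)
      fix C assume C: "C \<subseteq> E - Z"
      have "{F. F \<in> ?L \<and> (\<forall>g\<in>C. F g = H g)} = cone ?L (\<lambda>g. if g \<in> C then H g else Zero)"
        using C zH by (fastforce simp: cone_def sign_vector_le_iff)
      moreover have "H \<in> cone ?L (\<lambda>g. if g \<in> C then H g else Zero)"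
        using max_face(1,2)[of e Q] zH True by (auto simp: cone_def L sign_vector_le_iff H_def[symmetric])
      ultimately show "(\<Sum>F | F \<in> ?L \<and> (\<forall>g\<in>C. F g = H g). \<epsilon> * w F) = 1"
        using w' by (auto simp: euler_weight_def)
    qed (auto simp: finite_ground contraction_def finite_covectors)
    also have "(\<Prod>g\<in>E - Z. if G g = H g then 1 else (0::int)) = (if \<forall>g\<in>E - Z. G g = H g then 1 else 0)"
      using finite_ground by (intro prod_indicator) simp
    also have "(\<forall>g\<in>E - Z. G g = H g) \<longleftrightarrow> G = H"
      using zG zH offG offH by (metis DiffI ext)
    also have "(\<Sum>F\<in>?L. of_int (\<epsilon> * w F) * (\<Prod>g\<in>E - Z. if F g = H g then (if G g = H g then 1 else 0) else (if G g \<noteq> H g then 1 else 0)))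
      = (\<Sum>F\<in>?L. if \<forall>g\<in>E - Z. ?P F g then \<epsilon> * w F else 0)"
    proof (rule sum.cong)
      fix F
      have "(\<Prod>g\<in>E - Z. if F g = H g then (if G g = H g then 1 else 0) else (if G g \<noteq> H g then 1 else (0::int)))
        = (\<Prod>g\<in>E - Z. if ?P F g then 1 else 0)"
        by (intro prod.cong) auto
      also have "\<dots> = (if \<forall>g\<in>E - Z. ?P F g then 1 else 0)"
        using finite_ground by (intro prod_indicator) simp
      finally show "of_int (\<epsilon> * w F) * (\<Prod>g\<in>E - Z. if F g = H g then (if G g = H g then 1 else 0) else (if G g \<noteq> H g then 1 else 0))
        = (if \<forall>g\<in>E - Z. ?P F g then \<epsilon> * w F else 0)" by simp
    qed simp
    also have "\<dots> = (\<Sum>F | F \<in> ?L \<and> (\<forall>g\<in>E - Z. ?P F g). \<epsilon> * w F)"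
      using finite_covectors by (intro sum.inter_filter[symmetric]) (simp add: contraction_def)
    also have "\<dots> = \<epsilon> * coeff e w R Q"
      unfolding coeff_def eq by (simp add: sum_distrib_left)
    finally show ?thesis
      using \<epsilon> by (auto simp: G_def H_def split: if_splits)
  qed
  then show ?thesis using \<epsilon> by blast
qed

lemma vweight_face_reflect:
  assumes "Q \<in> topes L" "F \<le> Q"
  shows "vweight E u (reflect F Q) Q = prod u (zeros F)" "vweight E u Q (reflect F Q) = prod u (zeros F)"
proof -
  have "reflect F Q g = Q g \<longleftrightarrow> F g \<noteq> Zero" if "g \<in> E" for g
    using assms(2) tope_nonzero[OF assms(1) that] by (auto simp: reflect_apply sign_vector_le_iff)
  then show "vweight E u (reflect F Q) Q = prod u (zeros F)"
    unfolding vweight_def zeros_def prod.inter_filter[OF finite_ground] by (intro prod.cong) auto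
  then show "vweight E u Q (reflect F Q) = prod u (zeros F)"
    by (simp add: vweight_def eq_commute)
qed

text \<open>
  The size of the support of \<open>max_face e Q\<close> serves as the height in \<open>gdet_matching\<close>, and reflection at
  \<open>max_face e Q\<close> as the matching.
\<close>
lemma gdet_transition:
  assumes e: "e \<in> E" and w: "euler_weight (contraction L {e}) w"
    and K: "K \<subseteq> topes L"
    and one: "good 1" and mult: "\<And>x y. good x \<Longrightarrow> good y \<Longrightarrow> good (x * y)"
    and factor: "\<And>F. F \<in> L \<Longrightarrow> F e = Zero \<Longrightarrow> good (1 - (prod u (zeros F))\<^sup>2)"
  shows "good (gdet K (transition u e w))"
proof (rule gdet_matching[where good = good and h = "\<lambda>Q. card (E - zeros (max_face e Q))"
    and \<tau> = "\<lambda>Q. reflect (max_face e Q) Q"])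
  show "finite K" using K finite_topes finite_subset by blast
next
  show "transition u e w Q Q = 1" if "Q \<in> K" for Q
    using that K e coeff_diagonal by (auto simp: transition_def)
next
  fix R Q assume RQ: "R \<in> K" "Q \<in> K" "R \<noteq> Q" "transition u e w R Q \<noteq> 0"
  then have c: "coeff e w R Q \<noteq> 0" by (auto simp: transition_def)
  have sub: "E - zeros (max_face e Q) \<subseteq> E - zeros (max_face e R)"
    using coeff_nonzero_supports(1)[OF c] by (auto simp: zeros_def)
  show "card (E - zeros (max_face e Q)) < card (E - zeros (max_face e R)) \<or> R = reflect (max_face e Q) Q"
  proof (cases "zeros (max_face e Q) = zeros (max_face e R)")
    case True
    have "max_face e R = max_face e Q"
      using coeff_same_support[OF w, of "zeros (max_face e R)"] True c coeff_nonzero_supports(2)[OF c] RQ K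
      by (metis subsetD)
    then show ?thesis using coeff_nonzero_supports(2)[OF c] by simp
  next
    case False
    then have "E - zeros (max_face e Q) \<subset> E - zeros (max_face e R)"
      using sub by (auto simp: zeros_def)
    then show ?thesis using finite_ground by (simp add: psubset_card_mono)
  qed
next
  fix Q assume Q: "Q \<in> K" "reflect (max_face e Q) Q \<in> K"
  let ?G = "max_face e Q"
  let ?R = "reflect ?G Q"
  have G: "max_face e ?R = ?G" and RR: "reflect ?G ?R = Q" by (rule max_face_reflect)+
  have tQ: "Q \<in> topes L" and tR: "?R \<in> topes L" using Q K by auto
  have "?R e = - Q e" using max_face(2)[of e Q] by (simp add: reflect_apply)
  then have "?R e \<noteq> Q e" using tope_nonzero[OF tQ e] by simp
  then have ne: "?R \<noteq> Q" by metis
  obtain \<epsilon> where \<epsilon>: "\<epsilon> = 1 \<or> \<epsilon> = -1" and c: "\<forall>R\<in>topes L. \<forall>Q\<in>topes L.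
      zeros (max_face e R) = zeros ?G \<longrightarrow> zeros (max_face e Q) = zeros ?G \<longrightarrow> R = reflect (max_face e R) Q \<longrightarrow>
      coeff e w R Q = (if max_face e R = max_face e Q then \<epsilon> else 0)"
    using coeff_same_support[OF w, of "zeros ?G"] by blast
  have "coeff e w ?R Q = \<epsilon>" "coeff e w Q ?R = \<epsilon>"
    using c tQ tR G RR by auto
  then have "transition u e w Q ?R * transition u e w ?R Q = (of_int \<epsilon> * prod u (zeros ?G))\<^sup>2"
    using ne vweight_face_reflect[OF tQ max_face(3), of u e]
    by (simp add: transition_def power2_eq_square)
  also have "\<dots> = (prod u (zeros ?G))\<^sup>2" using \<epsilon> by auto
  finally show "reflect (max_face e ?R) ?R = Q \<and> ?R \<noteq> Q \<and>
      card (E - zeros (max_face e ?R)) = card (E - zeros ?G) \<and>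
      good (1 - transition u e w Q ?R * transition u e w ?R Q)"
    using G RR ne factor[of ?G] max_face(1,2)[of e Q] by simp
qed (fact one mult)+

section \<open>The determinant of the Varchenko matrix\<close>

text \<open>
  The generalization from all topes to the topes above \<open>Y\<close> is what makes the induction work: both
  diagonal blocks of the first factor are again of this form, with one more sign prescribed.
\<close>
lemma gdet_vweight_cone:
  assumes one: "good 1" and mult: "\<And>x y. good x \<Longrightarrow> good y \<Longrightarrow> good (x * y)"
    and factor: "\<And>F. F \<in> L \<Longrightarrow> F \<notin> topes L \<Longrightarrow> good (1 - (prod u (zeros F))\<^sup>2)"
  shows "good (gdet {T \<in> topes L. Y \<le> T} (vweight E u))"
proof (induction "card {T \<in> topes L. Y \<le> T}" arbitrary: Y rule: less_induct)
  case less
  let ?K = "\<lambda>Y. {T \<in> topes L. Y \<le> T}"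
  have finK: "finite (?K Y)" for Y using finite_topes by simp
  show ?case
  proof (cases "\<exists>P\<in>?K Y. \<exists>Q\<in>?K Y. P \<noteq> Q")
    case False
    then consider "?K Y = {}" | P where "?K Y = {P}" by blast
    then show ?thesis
      by cases (use one in \<open>simp_all only: gdet_empty gdet_singleton vweight_self\<close>)
  next
    case True
    then obtain P Q where PQ: "P \<in> ?K Y" "Q \<in> ?K Y" "P \<noteq> Q" by blast
    then obtain e where Pe: "P e \<noteq> Q e" by (meson ext)
    have e: "e \<in> E" using PQ Pe tope_zero_iff by (metis (no_types, lifting) mem_Collect_eq)
    have Ye: "Y e = Zero" using PQ Pe by (auto simp: sign_vector_le_iff)
    interpret e: oriented_matroid E "contraction L {e}" by (rule contraction_oriented_matroid)
    obtain w where w: "euler_weight (contraction L {e}) w" using e.euler_weight_exists by blast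
    let ?B = "\<lambda>P R. if P e = R e then vweight E u P R else 0"
    let ?P = "?K (Y(e := Pos))" and ?N = "?K (Y(e := Neg))"
    have "gdet (?K Y) (vweight E u) = gdet (?K Y) (\<lambda>P Q. \<Sum>R\<in>?K Y. ?B P R * transition u e w R Q)"
      by (rule gdet_cong[OF refl]) (rule vweight_factorization[OF e w refl])
    also have "\<dots> = gdet (?K Y) ?B * gdet (?K Y) (transition u e w)"
      by (rule gdet_mult[OF finK])
    also have "gdet (?K Y) ?B = gdet ?P (vweight E u) * gdet ?N (vweight E u)"
    proof -
      have K: "?K Y = ?P \<union> ?N"
      proof (intro equalityI subsetI)
        fix T assume T: "T \<in> ?K Y"
        then have "T e \<noteq> Zero" using tope_nonzero e by blast
        then show "T \<in> ?P \<union> ?N" using T by (cases "T e") (auto simp: sign_vector_le_iff)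
      next
        fix T assume "T \<in> ?P \<union> ?N"
        then show "T \<in> ?K Y" using Ye by (auto simp: sign_vector_le_iff split: if_splits)
      qed
      have sP: "T e = Pos" if "T \<in> ?P" for T using that by (auto simp: sign_vector_le_iff dest: spec[of _ e])
      have sN: "T e = Neg" if "T \<in> ?N" for T using that by (auto simp: sign_vector_le_iff dest: spec[of _ e])
      have "gdet (?P \<union> ?N) ?B = gdet ?P ?B * gdet ?N ?B"
      proof (rule gdet_Un)
        show "?P \<inter> ?N = {}" using sP sN by fastforce
        show "?B R S = 0" if "R \<in> ?P" "S \<in> ?N" for R S using sP[OF that(1)] sN[OF that(2)] by simp
      qed (rule finK)+
      moreover have "gdet ?P ?B = gdet ?P (vweight E u)"
        by (rule gdet_cong[OF refl]) (simp only: sP if_True refl)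
      moreover have "gdet ?N ?B = gdet ?N (vweight E u)"
        by (rule gdet_cong[OF refl]) (simp only: sN if_True refl)
      ultimately show ?thesis using K by simp
    qed
    moreover have "good (gdet (?K (Y(e := s))) (vweight E u))" if "s \<noteq> Zero" for s
    proof (rule less)
      have "?K (Y(e := s)) \<subseteq> ?K Y"
        using Ye by (auto simp: sign_vector_le_iff split: if_splits)
      moreover have "P \<notin> ?K (Y(e := s)) \<or> Q \<notin> ?K (Y(e := s))"
        using Pe that by (auto simp: sign_vector_le_iff)
      ultimately show "card (?K (Y(e := s))) < card (?K Y)"
        using PQ finK by (intro psubset_card_mono) blast+
    qed
    moreover have "good (gdet (?K Y) (transition u e w))"
    proof (rule gdet_transition[OF e w _ one mult])
      show "good (1 - (prod u (zeros F))\<^sup>2)" if "F \<in> L" "F e = Zero" for F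
        using that tope_nonzero[of F e] e by (intro factor) auto
    qed auto
    ultimately show ?thesis using mult by simp
  qed
qed

end

theorem theorem1p1:
  fixes E :: "'e set" and L :: "'e sign_vector set" and Ts :: "'e sign_vector list"
  assumes "oriented_matroid E L"
    and "loopless E L"
    and "distinct Ts" and "set Ts = topes L"
  shows "\<exists>b :: 'e sign_vector \<Rightarrow> nat.
    (\<forall>F\<in>topes L. b F = 0) \<and>
    det (varchenko_matrix E Ts :: ('e, 'k::field) mpolynomial mat) =
      (\<Prod>F\<in>L. (1 - (face_weight E F)\<^sup>2) ^ b F)"
proof -
  interpret oriented_matroid E L by fact
  interpret loopless_oriented_matroid E L by standard fact
  let ?u = "U :: 'e \<Rightarrow> ('e, 'k) mpolynomial"
  define good :: "('e, 'k) mpolynomial \<Rightarrow> bool" where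
    "good x \<longleftrightarrow> (\<exists>b :: 'e sign_vector \<Rightarrow> nat. (\<forall>F\<in>topes L. b F = 0) \<and>
      x = (\<Prod>F\<in>L. (1 - (face_weight E F)\<^sup>2) ^ b F))" for x
  have "good 1"
    unfolding good_def by (rule exI[of _ "\<lambda>_. 0"]) simp
  moreover have "good (x * y)" if "good x" "good y" for x y
  proof -
    from that obtain b c where
      "\<forall>F\<in>topes L. b F = 0" "x = (\<Prod>F\<in>L. (1 - (face_weight E F)\<^sup>2) ^ b F)"
      "\<forall>F\<in>topes L. c F = 0" "y = (\<Prod>F\<in>L. (1 - (face_weight E F)\<^sup>2) ^ c F)"
      unfolding good_def by blast
    then show ?thesis
      unfolding good_def
      by (intro exI[of _ "\<lambda>F. b F + c F"]) (simp add: power_add prod.distrib)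
  qed
  moreover have "good (1 - (prod ?u (zeros F))\<^sup>2)" if F: "F \<in> L" "F \<notin> topes L" for F
  proof -
    have "(\<Prod>G\<in>L. (1 - (face_weight E G)\<^sup>2) ^ (if G = F then 1 else 0)) =
        (\<Prod>G\<in>L. if G = F then 1 - (face_weight E G :: ('e, 'k) mpolynomial)\<^sup>2 else 1)"
      by (rule prod.cong) auto
    also have "\<dots> = 1 - (prod ?u (zeros F))\<^sup>2"
      using F(1) finite_covectors by (simp add: face_weight_def zeros_def)
    finally show ?thesis
      unfolding good_def using F(2)
      by (intro exI[of _ "\<lambda>G. if G = F then 1 else 0"]) auto
  qed
  ultimately have "good (gdet {T \<in> topes L. (\<lambda>_. Zero) \<le> T} (vweight E ?u))"
    by (rule gdet_vweight_cone)
  also have "{T \<in> topes L. (\<lambda>_. Zero) \<le> T} = topes L"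
    by (simp add: sign_vector_le_iff)
  finally have "good (gdet (set Ts) (vweight E ?u))"
    using assms(4) by simp
  moreover have "det (varchenko_matrix E Ts) = gdet (set Ts) (\<lambda>P Q. \<Prod>e\<in>Sep E P Q. ?u e)"
    unfolding varchenko_matrix_def by (rule det_eq_gdet[OF assms(3)])
  moreover have "gdet (set Ts) (\<lambda>P Q. \<Prod>e\<in>Sep E P Q. ?u e) = gdet (set Ts) (vweight E ?u)"
  proof (rule gdet_cong[OF refl])
    fix P Q assume "P \<in> set Ts" "Q \<in> set Ts"
    then have "P e \<noteq> Zero" "Q e \<noteq> Zero" if "e \<in> E" for e
      using that assms(4) tope_nonzero by blast+
    then have "Sep E P Q = {e \<in> E. P e \<noteq> Q e}"
      using sign_eq_uminus by (auto simp: Sep_def)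
    moreover have "(\<Prod>e\<in>{e \<in> E. P e \<noteq> Q e}. ?u e) = vweight E ?u P Q"
      unfolding vweight_def prod.inter_filter[OF finite_ground] by (rule prod.cong) auto
    ultimately show "(\<Prod>e\<in>Sep E P Q. ?u e) = vweight E ?u P Q" by simp
  qed
  ultimately show ?thesis by (simp add: good_def)
qed

end
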